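(* Let $M\ge 1$, let $0<x_1<x_2<\cdots<x_M$ be real numbers and let $a_1,\dots,a_M$ be real numbers, not all zero. Then the set of points $(x,y)\in\mathbb{R}^2\setminus\{(x_1,0),\dots,(x_M,0)\}$ with $X(x,y)=Y(x,y)=0$ is finite, where $$X(x,y)=\sum_{j=1}^M\frac{a_j(x-x_j)}{((x-x_j)^2+y^2)^{3/2}},\qquad Y(x,y)=\sum_{j=1}^M\frac{a_jy}{((x-x_j)^2+y^2)^{3/2}}.$$
   Context: The vector field $\mathbf{F}=(X,Y)$ is the planar electric field of charges $a_j$ placed at the points $(x_j,0)$ on the positive $x$-axis; its zero set is the set of points (away from the charges) where $X=Y=0$. *)

theory Defs
  imports "HOL-Analysis.Analysis"
begin

text \<open>
  The charges are indexed by \<open>1, \<dots>, M\<close>; values of \<open>a\<close> and \<open>x\<close> at other indices are irrelevant.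
  At a charge the base of \<open>powr\<close> is zero, so the corresponding summand is \<open>0\<close> by the conventions
  of HOL; these points are excluded from the zero set below.
\<close>

definition field_X :: "nat \<Rightarrow> (nat \<Rightarrow> real) \<Rightarrow> (nat \<Rightarrow> real) \<Rightarrow> real \<Rightarrow> real \<Rightarrow> real" where
  "field_X M a x u v =
     (\<Sum>j = 1..M. a j * (u - x j) / ((u - x j)\<^sup>2 + v\<^sup>2) powr (3 / 2))"

definition field_Y :: "nat \<Rightarrow> (nat \<Rightarrow> real) \<Rightarrow> (nat \<Rightarrow> real) \<Rightarrow> real \<Rightarrow> real \<Rightarrow> real" where
  "field_Y M a x u v =
     (\<Sum>j = 1..M. a j * v / ((u - x j)\<^sup>2 + v\<^sup>2) powr (3 / 2))"

definition field_zeros :: "nat \<Rightarrow> (nat \<Rightarrow> real) \<Rightarrow> (nat \<Rightarrow> real) \<Rightarrow> (real \<times> real) set" where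
  "field_zeros M a x =
     {(u, v). (u, v) \<notin> (\<lambda>j. (x j, 0)) ` {1..M} \<and> field_X M a x u v = 0 \<and> field_Y M a x u v = 0}"

end

theory Submission
  imports Defs
begin

text \<open>
  With \<open>z = u + \<i>v\<close>, the two components combine to \<open>X - \<i>Y = \<Sum>j. a\<^sub>j k(z - x\<^sub>j)\<close>, where
  \<open>k(z) = cnj z / \<bar>z\<bar>\<^sup>3\<close> is multiplicative and equals \<open>z\<close> to the power \<open>-3/2\<close> times the
  conjugate of \<open>z\<close> to the power \<open>-1/2\<close>. By the binomial series, \<open>k(1 + w)\<close> is therefore, for
  \<open>\<bar>w\<bar> < 1\<close>, a sum of homogeneous polynomials \<open>\<Phi>\<^sub>n\<close> of degree \<open>n\<close> in \<open>w\<close> and \<open>cnj w\<close>.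

  The zeros are shown to be isolated at every point of the extended plane; compactness then makes
  their number finite. By multiplicativity, \<open>k(z\<^sub>0 + w - x\<^sub>j) = k(z\<^sub>0 - x\<^sub>j) k(1 + s\<^sub>j w)\<close> with
  \<open>s\<^sub>j = 1 / (z\<^sub>0 - x\<^sub>j)\<close>, so near a point \<open>z\<^sub>0\<close> other than a charge the field is a superposition
  \<open>\<Sum>j. c\<^sub>j k(1 + s\<^sub>j w)\<close> with distinct \<open>s\<^sub>j\<close>; with \<open>w = 1/z\<close> and \<open>s\<^sub>j = - x\<^sub>j\<close> the same form
  appears near infinity. It suffices that the first nonzero homogeneous part of such a superposition
  vanishes only at \<open>w = 0\<close> (\<open>superposition_nonzero_of_leading_term\<close>).

  \<^item> On the axis and at infinity the \<open>s\<^sub>j\<close> are real, and the part of degree \<open>n\<close> is \<open>\<Phi>\<^sub>n(w)\<close> times the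
    moment \<open>\<Sum>j. c\<^sub>j s\<^sub>j\<^sup>n\<close>. Not all moments vanish, as the \<open>s\<^sub>j\<close> are distinct, and \<open>\<Phi>\<^sub>n\<close> has no
    zero apart from the origin by the Enestroem--Kakeya theorem, because the absolute values of its
    coefficients increase (\<open>coulomb_poly_nonzero\<close>, \<open>superposition_nonzero_real\<close>).
  \<^item> Off the axis the \<open>s\<^sub>j\<close> lie on a circle through the origin, the image of the axis under inversion.
    The equation of the circle is a recurrence between the mixed moments of \<open>s\<^sub>j\<close> and \<open>cnj s\<^sub>j\<close>, which
    forces the leading part to be a multiple of \<open>w\<^sup>N\<close> (\<open>superposition_nonzero_nonreal\<close>). This
    is the algebraic form of the fact that the leading Taylor polynomial of an axisymmetric
    harmonic potential at a point off the axis is harmonic in the plane.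

  Close to a charge its own field dominates.
\<close>

section \<open>The complex Coulomb field and its homogeneous expansion\<close>

text \<open>
  This is the conjugate of the field of a unit charge at the origin; conjugating makes the function
  multiplicative.
\<close>

definition coulomb :: "complex \<Rightarrow> complex" where
  "coulomb z = cnj z / of_real (norm z ^ 3)"

lemma coulomb_mult: "coulomb (z * w) = coulomb z * coulomb w"
  by (simp add: coulomb_def norm_mult power_mult_distrib)

lemma coulomb_eq_0_iff [simp]: "coulomb z = 0 \<longleftrightarrow> z = 0"
  by (simp add: coulomb_def)

lemma continuous_on_coulomb: "continuous_on (- {0}) coulomb"
  unfolding coulomb_def by (intro continuous_intros) auto

text \<open>
  The part of degree \<open>n\<close> in the Cauchy product of the binomial series for the exponent \<open>-3/2\<close> in \<open>u\<close>
  and the exponent \<open>-1/2\<close> in \<open>cnj u\<close>.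
\<close>

definition coulomb_poly :: "nat \<Rightarrow> complex \<Rightarrow> complex" where
  "coulomb_poly n u = (\<Sum>i\<le>n. ((-3/2) gchoose i) * ((-1/2) gchoose (n - i)) * u ^ i * cnj u ^ (n - i))"

lemma coulomb_eq_powr:
  assumes "z \<noteq> 0"
  shows "coulomb z = z powr (-3/2) * cnj (z powr (-1/2))"
proof -
  have "z powr (-3/2) = z powr (-1/2) * z powr (-1)"
    by (simp add: powr_add [symmetric])
  also have "z powr (-1) = inverse z"
    using assms by (simp add: powr_minus)
  finally have "z powr (-3/2) * cnj (z powr (-1/2)) = (z powr (-1/2) * cnj (z powr (-1/2))) / z"
    by (simp add: field_simps)
  also have "z powr (-1/2) * cnj (z powr (-1/2)) = of_real (norm (z powr (-1/2)) ^ 2)"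
    by (rule complex_norm_square [symmetric])
  also have "norm (z powr (-1/2)) ^ 2 = 1 / norm z"
  proof -
    have "norm (z powr (-1/2)) = norm z powr (-1/2)"
      by (subst norm_powr_real_powr') auto
    then have "norm (z powr (-1/2)) ^ 2 = norm z powr (-1/2) * norm z powr (-1/2)"
      by (simp only: power2_eq_square)
    also have "\<dots> = norm z powr (-1)"
      by (simp flip: powr_add)
    finally show ?thesis
      using assms by (simp add: powr_minus_divide)
  qed
  also have "of_real (1 / norm z) / z = coulomb z"
  proof -
    have "z * cnj z = of_real (norm z) ^ 2"
      using complex_norm_square [of z] by simp
    then show ?thesis
      using assms by (simp add: coulomb_def field_simps power2_eq_square power3_eq_cube)
  qed
  finally show ?thesis ..
qed

lemma summable_norm_gbinomial_power:
  fixes a u :: "'a :: {real_normed_field, banach, field_char_0}"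
  assumes "norm u < 1"
  shows "summable (\<lambda>n. norm ((a gchoose n) * u ^ n))"
proof (rule abs_summable_in_conv_radius)
  show "ereal (norm u) < conv_radius (\<lambda>n. a gchoose n)"
    using assms by (simp add: conv_radius_gchoose)
qed

lemma coulomb_poly_sums_coulomb:
  assumes "norm u < 1"
  shows "(\<lambda>n. coulomb_poly n u) sums coulomb (1 + u)"
proof -
  have nz: "1 + u \<noteq> 0"
    using assms by (metis add_eq_0_iff less_irrefl norm_minus_cancel norm_one)
  let ?a = "\<lambda>n. ((-3/2) gchoose n) * u ^ n" and ?b = "\<lambda>n. ((-1/2) gchoose n) * cnj u ^ n"
  have a: "?a sums (1 + u) powr (-3/2)"
    using assms by (rule gen_binomial_complex)
  have cnj_gchoose: "cnj (- (1/2) gchoose n) = - (1/2) gchoose n" for n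
    by (simp add: gbinomial_prod_rev)
  have b: "?b sums cnj ((1 + u) powr (-1/2))"
    using sums_cnj [THEN iffD2, OF gen_binomial_complex [OF assms, of "-1/2"]]
    by (simp add: cnj_gchoose)
  have "(\<lambda>n. \<Sum>i\<le>n. ?a i * ?b (n - i)) sums ((\<Sum>n. ?a n) * (\<Sum>n. ?b n))"
    using assms by (intro Cauchy_product_sums summable_norm_gbinomial_power) auto
  also have "(\<Sum>n. ?a n) * (\<Sum>n. ?b n) = coulomb (1 + u)"
    using nz sums_unique [OF a] sums_unique [OF b] by (simp add: coulomb_eq_powr)
  finally show ?thesis
    by (simp add: coulomb_poly_def mult_ac)
qed

text \<open>
  Once \<open>\<bar>u\<bar>\<close> to the power \<open>N + 1\<close> is extracted from the tail of the expansion, the rest is bounded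
  by its majorant at \<open>\<bar>u\<bar> = 1/2\<close>, where the Cauchy product of the absolute values of the two series converges.
\<close>

lemma coulomb_remainder:
  obtains C where "\<And>u. norm u \<le> 1/2 \<Longrightarrow>
    norm (coulomb (1 + u) - (\<Sum>n\<le>N. coulomb_poly n u)) \<le> C * norm u ^ Suc N"
proof -
  define K where "K n = (\<Sum>i\<le>n. norm ((-3/2 :: complex) gchoose i) * norm ((-1/2 :: complex) gchoose (n - i)))" for n
  have bound: "norm (coulomb_poly n u) \<le> K n * norm u ^ n" for n u
    unfolding coulomb_poly_def K_def sum_distrib_right
  proof (rule sum_norm_le)
    fix i assume "i \<in> {..n}"
    then have "norm u ^ i * norm u ^ (n - i) = norm u ^ n"
      by (simp flip: power_add)
    then show "norm (((-3/2) gchoose i) * ((-1/2) gchoose (n - i)) * u ^ i * cnj u ^ (n - i))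
        \<le> norm ((-3/2 :: complex) gchoose i) * norm ((-1/2 :: complex) gchoose (n - i)) * norm u ^ n"
      by (simp add: norm_mult norm_power mult.assoc)
  qed
  have "summable (\<lambda>n. \<Sum>i\<le>n. norm (((-3/2 :: complex) gchoose i) * (1/2) ^ i) *
          norm (((-1/2 :: complex) gchoose (n - i)) * (1/2) ^ (n - i)))"
    by (intro summable_Cauchy_product) (auto intro!: summable_norm_gbinomial_power)
  also have "(\<lambda>n. \<Sum>i\<le>n. norm (((-3/2 :: complex) gchoose i) * (1/2) ^ i) *
          norm (((-1/2 :: complex) gchoose (n - i)) * (1/2) ^ (n - i))) = (\<lambda>n. K n * (1/2) ^ n)"
  proof
    fix n
    show "(\<Sum>i\<le>n. norm (((-3/2 :: complex) gchoose i) * (1/2) ^ i) *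
          norm (((-1/2 :: complex) gchoose (n - i)) * (1/2) ^ (n - i))) = K n * (1/2) ^ n"
      unfolding K_def sum_distrib_right
    proof (rule sum.cong [OF refl])
      fix i assume "i \<in> {..n}"
      then have "(1/2 :: real) ^ i * (1/2) ^ (n - i) = (1/2) ^ n"
        by (simp flip: power_add)
      then show "norm (((-3/2 :: complex) gchoose i) * (1/2) ^ i) *
          norm (((-1/2 :: complex) gchoose (n - i)) * (1/2) ^ (n - i)) =
          norm ((-3/2 :: complex) gchoose i) * norm ((-1/2 :: complex) gchoose (n - i)) * (1/2) ^ n"
        by (simp add: norm_mult norm_power norm_divide)
    qed
  qed
  finally have sumK: "summable (\<lambda>n. K (n + Suc N) * (1/2) ^ (n + Suc N))"
    by (rule summable_ignore_initial_segment)
  define C where "C = 2 ^ Suc N * (\<Sum>n. K (n + Suc N) * (1/2) ^ (n + Suc N))"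
  show thesis
  proof
    fix u :: complex
    assume u: "norm u \<le> 1/2"
    have K0: "K n \<ge> 0" for n
      by (simp add: K_def sum_nonneg)
    have le: "norm (coulomb_poly (n + Suc N) u)
        \<le> (2 * norm u) ^ Suc N * (K (n + Suc N) * (1/2) ^ (n + Suc N))" for n
    proof -
      have "norm u ^ n \<le> (1/2) ^ n"
        using u by (intro power_mono) auto
      then have "norm u ^ Suc N * norm u ^ n * K (n + Suc N)
          \<le> norm u ^ Suc N * (1/2) ^ n * K (n + Suc N)"
        using K0 by (intro mult_right_mono mult_left_mono) auto
      also have "\<dots> = (2 * norm u) ^ Suc N * (K (n + Suc N) * (1/2) ^ (n + Suc N))"
        unfolding power_mult_distrib power_add by (simp add: power_divide)
      finally show ?thesis
        using bound [of "n + Suc N" u] by (simp add: power_add mult_ac)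
    qed
    have sm: "summable (\<lambda>n. (2 * norm u) ^ Suc N * (K (n + Suc N) * (1/2) ^ (n + Suc N)))"
      using sumK by (rule summable_mult)
    have "(\<lambda>n. coulomb_poly n u) sums coulomb (1 + u)"
      using u by (intro coulomb_poly_sums_coulomb) auto
    then have "coulomb (1 + u) - (\<Sum>n\<le>N. coulomb_poly n u) = (\<Sum>n. coulomb_poly (n + Suc N) u)"
      using suminf_minus_initial_segment [of "\<lambda>n. coulomb_poly n u" "Suc N"]
      by (simp add: sums_iff lessThan_Suc_atMost del: sum.lessThan_Suc)
    also have "norm \<dots> \<le> (\<Sum>n. (2 * norm u) ^ Suc N * (K (n + Suc N) * (1/2) ^ (n + Suc N)))"
      using le sm by (rule norm_suminf_le)
    also have "\<dots> = C * norm u ^ Suc N"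
      using suminf_mult [OF sumK, of "(2 * norm u) ^ Suc N"]
      unfolding C_def power_mult_distrib by (simp only: mult_ac)
    finally show "norm (coulomb (1 + u) - (\<Sum>n\<le>N. coulomb_poly n u)) \<le> C * norm u ^ Suc N" .
  qed
qed

lemma coulomb_poly_scale_real:
  "coulomb_poly n (of_real t * u) = of_real t ^ n * coulomb_poly n u"
  unfolding coulomb_poly_def sum_distrib_left
proof (rule sum.cong [OF refl])
  fix i assume "i \<in> {..n}"
  then have "of_real t ^ n = (of_real t ^ i * of_real t ^ (n - i) :: complex)"
    by (simp flip: power_add)
  then show "((-3/2) gchoose i) * ((-1/2) gchoose (n - i)) * (of_real t * u) ^ i * cnj (of_real t * u) ^ (n - i)
    = of_real t ^ n * (((-3/2) gchoose i) * ((-1/2) gchoose (n - i)) * u ^ i * cnj u ^ (n - i))"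
    by (simp add: power_mult_distrib)
qed

lemma continuous_on_coulomb_poly [continuous_intros]:
  assumes "continuous_on S f"
  shows "continuous_on S (\<lambda>u. coulomb_poly n (f u))"
  unfolding coulomb_poly_def by (intro continuous_intros assms)

section \<open>Isolated zeros from a nondegenerate leading part\<close>

text \<open>
  The leading part is homogeneous of degree \<open>N\<close> under real scaling, so by compactness of the unit
  circle it is at least \<open>m \<bar>w\<bar>\<^sup>N\<close> in absolute value for some \<open>m > 0\<close>, and it beats the remainder,
  which is smaller by a factor of order \<open>\<bar>w\<bar>\<close>.
\<close>

lemma superposition_nonzero_of_leading_term:
  fixes c s :: "'i \<Rightarrow> complex"
  assumes "finite J"
    and low: "\<And>n w. n < N \<Longrightarrow> (\<Sum>j\<in>J. c j * coulomb_poly n (s j * w)) = 0"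
    and lead: "\<And>w. w \<noteq> 0 \<Longrightarrow> (\<Sum>j\<in>J. c j * coulomb_poly N (s j * w)) \<noteq> 0"
  shows "\<forall>\<^sub>F w in at 0. (\<Sum>j\<in>J. c j * coulomb (1 + s j * w)) \<noteq> 0"
proof -
  define P where "P w = (\<Sum>j\<in>J. c j * coulomb_poly N (s j * w))" for w
  have "\<exists>w0\<in>sphere (0::complex) 1. \<forall>w\<in>sphere 0 1. norm (P w0) \<le> norm (P w)"
    unfolding P_def by (intro continuous_attains_inf continuous_intros) auto
  then obtain w0 where w0: "norm w0 = 1" "\<And>w. norm w = 1 \<Longrightarrow> norm (P w0) \<le> norm (P w)"
    by auto
  define m where "m = norm (P w0)"
  have "w0 \<noteq> 0"
    using w0(1) by auto
  then have m: "m > 0"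
    using lead [of w0] by (simp add: m_def P_def)
  have lower: "m * norm w ^ N \<le> norm (P w)" if "w \<noteq> 0" for w
  proof -
    have "P w = of_real (norm w) ^ N * P (sgn w)"
    proof -
      have "s j * w = of_real (norm w) * (s j * sgn w)" for j
        using that by (simp add: sgn_eq)
      then have "coulomb_poly N (s j * w) = of_real (norm w) ^ N * coulomb_poly N (s j * sgn w)" for j
        using coulomb_poly_scale_real by metis
      then show ?thesis
        by (simp add: P_def sum_distrib_left mult_ac)
    qed
    moreover have "m \<le> norm (P (sgn w))"
      unfolding m_def using that by (intro w0) (simp add: norm_sgn)
    ultimately show ?thesis
      by (simp add: norm_mult norm_power mult.commute [of m] mult_left_mono)
  qed
  obtain C where C: "\<And>u. norm u \<le> 1/2 \<Longrightarrow>
    norm (coulomb (1 + u) - (\<Sum>n\<le>N. coulomb_poly n u)) \<le> C * norm u ^ Suc N"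
    using coulomb_remainder by blast
  define K where "K = (\<Sum>j\<in>J. norm (c j) * (C * norm (s j) ^ Suc N))"
  have small: "\<forall>\<^sub>F w in at 0. \<forall>j\<in>J. norm (s j * w) < 1/2"
    using assms(1)
  proof (intro eventually_ball_finite ballI)
    fix j
    have "((\<lambda>w. norm (s j * w)) \<longlongrightarrow> norm (s j * 0)) (at 0)"
      by (intro tendsto_intros)
    then show "\<forall>\<^sub>F w in at 0. norm (s j * w) < 1/2"
      by (rule order_tendstoD) auto
  qed
  have "((\<lambda>w::complex. K * norm w) \<longlongrightarrow> K * norm (0::complex)) (at 0)"
    by (intro tendsto_intros)
  then have Ksmall: "\<forall>\<^sub>F w::complex in at 0. K * norm w < m"
    by (rule order_tendstoD) (use m in auto)
  have nz: "\<forall>\<^sub>F w::complex in at 0. w \<noteq> 0"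
    by (simp add: eventually_at_filter)
  show ?thesis
    using small Ksmall nz
  proof eventually_elim
    case (elim w)
    let ?F = "\<Sum>j\<in>J. c j * coulomb (1 + s j * w)"
    have "(\<Sum>j\<in>J. c j * (\<Sum>n\<le>N. coulomb_poly n (s j * w)))
        = (\<Sum>n\<le>N. \<Sum>j\<in>J. c j * coulomb_poly n (s j * w))"
      unfolding sum_distrib_left by (rule sum.swap)
    also have "\<dots> = P w"
      using low by (simp add: P_def lessThan_Suc_atMost [symmetric])
    finally have "?F - P w = (\<Sum>j\<in>J. c j * (coulomb (1 + s j * w) - (\<Sum>n\<le>N. coulomb_poly n (s j * w))))"
      by (simp add: right_diff_distrib sum_subtractf)
    also have "norm \<dots> \<le> (\<Sum>j\<in>J. norm (c j) * (C * norm (s j * w) ^ Suc N))"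
    proof (rule sum_norm_le)
      fix j assume "j \<in> J"
      then have "norm (s j * w) \<le> 1/2"
        using elim(1) less_imp_le by blast
      then show "norm (c j * (coulomb (1 + s j * w) - (\<Sum>n\<le>N. coulomb_poly n (s j * w))))
          \<le> norm (c j) * (C * norm (s j * w) ^ Suc N)"
        unfolding norm_mult [of "c j"] by (intro mult_left_mono C norm_ge_zero)
    qed
    also have "\<dots> = K * norm w * norm w ^ N"
      by (simp add: K_def sum_distrib_left norm_mult power_mult_distrib mult_ac)
    also have "\<dots> < m * norm w ^ N"
      using elim by (intro mult_strict_right_mono) auto
    also have "\<dots> \<le> norm (P w)"
      using elim(3) by (rule lower)
    finally show "?F \<noteq> 0"
      by auto
  qed
qed

section \<open>Superpositions with real parameters\<close>

text \<open>
  If all power moments vanish, so do all sums \<open>\<Sum>j. c\<^sub>j p(s\<^sub>j)\<close> with a polynomial \<open>p\<close>; a \<open>p\<close> vanishing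
  at all nodes except \<open>s\<^sub>k\<close> isolates \<open>c\<^sub>k\<close>.
\<close>

lemma power_moments_eq_0_imp:
  fixes c s :: "'i \<Rightarrow> 'a :: field"
  assumes "finite J" "inj_on s J" "\<And>n. (\<Sum>j\<in>J. c j * s j ^ n) = 0" "k \<in> J"
  shows "c k = 0"
proof -
  have *: "(\<Sum>j\<in>J. c j * poly p (s j)) = 0" for p
  proof -
    have "(\<Sum>j\<in>J. c j * poly p (s j)) = (\<Sum>i\<le>degree p. coeff p i * (\<Sum>j\<in>J. c j * s j ^ i))"
      unfolding poly_altdef sum_distrib_left by (subst sum.swap) (simp add: mult_ac)
    then show ?thesis
      by (simp add: assms(3))
  qed
  define p where "p = (\<Prod>i\<in>J - {k}. [:- s i, 1:])"
  have "poly p (s j) = 0" if "j \<in> J - {k}" for j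
    using that assms(1) by (auto simp: p_def poly_prod)
  then have "(\<Sum>j\<in>J. c j * poly p (s j)) = c k * poly p (s k)"
    using assms(1,4) by (subst sum.remove [of _ k]) auto
  moreover have "poly p (s k) \<noteq> 0"
    using assms(1,2,4) by (auto simp: p_def poly_prod inj_on_def)
  ultimately show ?thesis
    using * by simp
qed

text \<open>
  Multiplying by \<open>1 - z\<close> turns the coefficients into \<open>b\<^sub>0\<close> and the positive differences of consecutive
  \<open>b\<^sub>i\<close>, which together sum to \<open>b\<^sub>n\<close>. Hence \<open>(1 - z) (\<Sum>i\<le>n. b\<^sub>i z\<^sup>i)\<close> is \<open>- b\<^sub>n\<close> times the power \<open>n + 1\<close> of \<open>z\<close>, plus an
  expression \<open>T\<close> of absolute value at most \<open>b\<^sub>n\<close>. For \<open>z \<noteq> 1\<close> and \<open>n \<ge> 1\<close> the triangle inequality is already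
  strict for the first two summands of \<open>T\<close>, so the two cannot cancel.
\<close>

lemma Enestroem_Kakeya_unit_circle:
  fixes b :: "nat \<Rightarrow> real" and z :: complex
  assumes pos: "0 < b 0" and incr: "\<And>i. i < n \<Longrightarrow> b i < b (Suc i)" and z: "norm z = 1"
  shows "(\<Sum>i\<le>n. of_real (b i) * z ^ i) \<noteq> 0"
proof (cases "z = 1 \<or> n = 0")
  case True
  have "0 < b i" if "i \<le> n" for i
    using that
  proof (induction i)
    case (Suc i)
    then show ?case
      using incr [of i] by auto
  qed (use pos in auto)
  then have "0 < (\<Sum>i\<le>n. b i)"
    by (intro sum_pos) auto
  then have "complex_of_real (\<Sum>i\<le>n. b i) \<noteq> 0"
    by (simp del: of_real_sum)
  with True pos show ?thesis
    by auto
next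
  case False
  let ?T = "\<lambda>k. (1 - z) * (\<Sum>i\<le>k. of_real (b i) * z ^ i) + of_real (b k) * z ^ Suc k"
  have "norm (?T (Suc k)) < b (Suc k)" if "Suc k \<le> n" for k
    using that
  proof (induction k)
    case 0
    have inc: "b 0 < b (Suc 0)"
      using incr 0 by auto
    have T: "?T (Suc 0) = of_real (b 0) + of_real (b (Suc 0) - b 0) * z"
      by (simp add: algebra_simps)
    have "norm (?T (Suc 0)) \<le> b 0 + (b (Suc 0) - b 0)"
      unfolding T using norm_triangle_ineq [of "of_real (b 0)" "of_real (b (Suc 0) - b 0) * z"] pos inc z
      by (simp add: norm_mult del: of_real_diff)
    moreover have "norm (?T (Suc 0)) \<noteq> b 0 + (b (Suc 0) - b 0)"
    proof
      assume "norm (?T (Suc 0)) = b 0 + (b (Suc 0) - b 0)"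
      then have "norm (of_real (b 0) + of_real (b (Suc 0) - b 0) * z)
          = norm (of_real (b 0) :: complex) + norm (of_real (b (Suc 0) - b 0) * z)"
        unfolding T using pos inc z by (simp add: norm_mult del: of_real_diff)
      then have "b 0 *\<^sub>R (of_real (b (Suc 0) - b 0) * z) = (b (Suc 0) - b 0) *\<^sub>R (of_real (b 0) :: complex)"
        unfolding norm_triangle_eq using pos inc z by (simp add: norm_mult del: of_real_diff)
      then have "of_real (b 0 * (b (Suc 0) - b 0)) * z = complex_of_real (b 0 * (b (Suc 0) - b 0))"
        by (simp add: scaleR_conv_of_real mult_ac del: of_real_diff)
      then show False
        using pos inc False by (simp del: of_real_diff)
    qed
    ultimately show ?case
      by simp
  next
    case (Suc k)
    have "?T (Suc (Suc k)) = ?T (Suc k) + of_real (b (Suc (Suc k)) - b (Suc k)) * z ^ Suc (Suc k)"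
      by (simp add: algebra_simps)
    also have "norm \<dots> \<le> norm (?T (Suc k)) + (b (Suc (Suc k)) - b (Suc k))"
      using norm_triangle_ineq [of "?T (Suc k)" "of_real (b (Suc (Suc k)) - b (Suc k)) * z ^ Suc (Suc k)"]
        incr [of "Suc k"] Suc.prems z
      by (simp add: norm_mult norm_power del: of_real_diff power_Suc sum.atMost_Suc)
    also have "\<dots> < b (Suc (Suc k))"
      using Suc by simp
    finally show ?case .
  qed
  from this [of "n - 1"] have "norm (?T n) < b n"
    using False by simp
  then have "norm (?T n) < norm (of_real (b n) * z ^ Suc n)"
    using z by (simp add: norm_mult norm_power)
  then show ?thesis
    by auto
qed

text \<open>
  Up to sign, the coefficients of the two binomial series are \<open>(3/2)\<^sub>k / k!\<close>, which increases with
  \<open>k\<close>, and \<open>(1/2)\<^sub>k / k!\<close>, which decreases. Dividing by the power \<open>n\<close> of \<open>cnj u\<close> thus leaves a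
  polynomial with positive increasing coefficients in \<open>u / cnj u\<close>, a point of the unit circle.
\<close>

lemma coulomb_poly_nonzero:
  assumes "u \<noteq> 0"
  shows "coulomb_poly n u \<noteq> 0"
proof -
  define p where "p k = pochhammer (3/2 :: real) k / fact k" for k
  define q where "q k = pochhammer (1/2 :: real) k / fact k" for k
  have p: "0 < p k" "p k < p (Suc k)" for k
  proof -
    show 0: "0 < p k"
      by (simp add: p_def pochhammer_pos)
    have "p (Suc k) = p k * ((3/2 + k) / (1 + k))"
      by (simp add: p_def pochhammer_Suc field_simps)
    moreover have "p k * 1 < p k * ((3/2 + k) / (1 + k))"
      using 0 by (intro mult_strict_left_mono) (auto simp: field_simps)
    ultimately show "p k < p (Suc k)"
      by simp
  qed
  have q: "0 < q k" "q (Suc k) < q k" for k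
  proof -
    show 0: "0 < q k"
      by (simp add: q_def pochhammer_pos)
    have "q (Suc k) = q k * ((1/2 + k) / (1 + k))"
      by (simp add: q_def pochhammer_Suc field_simps)
    moreover have "q k * ((1/2 + k) / (1 + k)) < q k * 1"
      using 0 by (intro mult_strict_left_mono) (auto simp: field_simps)
    ultimately show "q (Suc k) < q k"
      by simp
  qed
  have gp: "(-3/2 :: complex) gchoose k = (-1) ^ k * of_real (p k)" for k
    using pochhammer_of_real [of "3/2" k, where ?'a = complex]
    by (simp add: gbinomial_pochhammer p_def)
  have gq: "(-1/2 :: complex) gchoose k = (-1) ^ k * of_real (q k)" for k
    using pochhammer_of_real [of "1/2" k, where ?'a = complex]
    by (simp add: gbinomial_pochhammer q_def)
  define z where "z = u / cnj u"
  have z: "norm z = 1" "u = z * cnj u"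
    using assms by (auto simp: z_def norm_divide)
  have "coulomb_poly n u = (-1) ^ n * cnj u ^ n * (\<Sum>i\<le>n. of_real (p i * q (n - i)) * z ^ i)"
    unfolding coulomb_poly_def sum_distrib_left
  proof (rule sum.cong [OF refl])
    fix i assume "i \<in> {..n}"
    then have *: "x ^ n = x ^ i * x ^ (n - i)" for x :: complex
      by (simp flip: power_add)
    have "u ^ i = z ^ i * cnj u ^ i"
      by (subst z(2)) (simp add: power_mult_distrib)
    then show "((-3/2) gchoose i) * ((-1/2) gchoose (n - i)) * u ^ i * cnj u ^ (n - i)
        = (-1) ^ n * cnj u ^ n * (of_real (p i * q (n - i)) * z ^ i)"
      unfolding gp gq * [of "-1"] * [of "cnj u"] by (simp add: mult_ac)
  qed
  moreover have "(\<Sum>i\<le>n. of_real (p i * q (n - i)) * z ^ i) \<noteq> 0"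
  proof (rule Enestroem_Kakeya_unit_circle)
    fix i assume "i < n"
    then have "q (n - i) < q (n - Suc i)"
      using q(2) [of "n - Suc i"] by (simp add: Suc_diff_Suc)
    then show "p i * q (n - i) < p (Suc i) * q (n - Suc i)"
      using p [of i] q(1) [of "n - i"] by (intro mult_strict_mono) (auto intro: less_imp_le)
  qed (use p q z in auto)
  ultimately show ?thesis
    using assms by simp
qed

lemma superposition_nonzero_real:
  fixes c :: "'i \<Rightarrow> complex" and t :: "'i \<Rightarrow> real"
  assumes "finite J" "inj_on t J" "k \<in> J" "c k \<noteq> 0"
  shows "\<forall>\<^sub>F w in at 0. (\<Sum>j\<in>J. c j * coulomb (1 + of_real (t j) * w)) \<noteq> 0"
proof -
  define \<mu> where "\<mu> n = (\<Sum>j\<in>J. c j * of_real (t j) ^ n)" for n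
  have "inj_on (\<lambda>j. complex_of_real (t j)) J"
    using assms(2) by (auto simp: inj_on_def)
  then have "\<exists>n. \<mu> n \<noteq> 0"
    using power_moments_eq_0_imp [of J "\<lambda>j. complex_of_real (t j)" c k] assms by (auto simp: \<mu>_def)
  then obtain N where N: "\<mu> N \<noteq> 0" "\<And>n. n < N \<Longrightarrow> \<mu> n = 0"
    using exists_least_iff [of "\<lambda>n. \<mu> n \<noteq> 0"] by blast
  have *: "(\<Sum>j\<in>J. c j * coulomb_poly n (of_real (t j) * w)) = \<mu> n * coulomb_poly n w" for n w
    unfolding \<mu>_def coulomb_poly_scale_real sum_distrib_right by (simp only: mult.assoc)
  show ?thesis
    using assms(1) N by (intro superposition_nonzero_of_leading_term [of J N]) (auto simp: * coulomb_poly_nonzero)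
qed

section \<open>Superpositions with parameters on a circle through the origin\<close>

text \<open>
  The part of degree \<open>n\<close> of the superposition involves the moments \<open>\<mu> i l\<close> with \<open>i + l = n + 1\<close> and
  \<open>i \<ge> 1\<close>. By the circle equation, \<open>\<mu> i l\<close> with both indices positive is a combination of two moments
  of total degree \<open>i + l - 1\<close>, while \<open>\<mu> 0 l\<close> is conjugate to \<open>\<mu> l 0\<close> as the \<open>b\<^sub>j\<close> are real. So if
  \<open>\<mu> (N + 1) 0\<close> is the first nonzero pure moment of positive degree, then all moments of
  total degree \<open>1, \<dots>, N\<close> vanish, and all mixed moments of total degree \<open>N + 1\<close> vanish as well.
\<close>

lemma superposition_nonzero_nonreal:
  fixes b :: "'i \<Rightarrow> real" and s :: "'i \<Rightarrow> complex" and \<kappa> :: complex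
  assumes "finite J" "inj_on s J" "k \<in> J" "b k \<noteq> 0" "\<And>j. j \<in> J \<Longrightarrow> s j \<noteq> 0" "\<kappa> \<noteq> 0"
    and circle: "\<And>j. j \<in> J \<Longrightarrow> s j - cnj (s j) = \<kappa> * (s j * cnj (s j))"
  shows "\<forall>\<^sub>F w in at 0. (\<Sum>j\<in>J. of_real (b j) * s j * coulomb (1 + s j * w)) \<noteq> 0"
proof -
  define \<mu> where "\<mu> i l = (\<Sum>j\<in>J. of_real (b j) * s j ^ i * cnj (s j) ^ l)" for i l
  have rec: "\<kappa> * \<mu> (Suc i) (Suc l) = \<mu> (Suc i) l - \<mu> i (Suc l)" for i l
    unfolding \<mu>_def sum_distrib_left sum_subtractf [symmetric]
  proof (rule sum.cong [OF refl])
    fix j assume "j \<in> J"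
    have "\<kappa> * (of_real (b j) * s j ^ Suc i * cnj (s j) ^ Suc l)
        = of_real (b j) * s j ^ i * cnj (s j) ^ l * (\<kappa> * (s j * cnj (s j)))"
      by (simp add: mult_ac)
    also have "\<dots> = of_real (b j) * s j ^ i * cnj (s j) ^ l * (s j - cnj (s j))"
      using circle [OF \<open>j \<in> J\<close>] by simp
    finally show "\<kappa> * (of_real (b j) * s j ^ Suc i * cnj (s j) ^ Suc l)
        = of_real (b j) * s j ^ Suc i * cnj (s j) ^ l - of_real (b j) * s j ^ i * cnj (s j) ^ Suc l"
      by (simp add: algebra_simps)
  qed
  have cnj_\<mu>: "\<mu> 0 l = cnj (\<mu> l 0)" for l
    by (simp add: \<mu>_def)
  have "\<exists>n. \<mu> (Suc n) 0 \<noteq> 0"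
  proof (rule ccontr)
    assume "\<nexists>n. \<mu> (Suc n) 0 \<noteq> 0"
    then have "(\<Sum>j\<in>J. (of_real (b j) * s j) * s j ^ n) = 0" for n
      by (simp add: \<mu>_def mult_ac)
    then have "of_real (b k) * s k = 0"
      using assms by (intro power_moments_eq_0_imp [of J s "\<lambda>j. of_real (b j) * s j" k]) auto
    then show False
      using assms by simp
  qed
  then obtain N where N: "\<mu> (Suc N) 0 \<noteq> 0" "\<And>n. n < N \<Longrightarrow> \<mu> (Suc n) 0 = 0"
    using exists_least_iff [of "\<lambda>n. \<mu> (Suc n) 0 \<noteq> 0"] by blast
  have zero: "\<mu> i l = 0" if "i + l = Suc n" "n < N" for i l n
    using that
  proof (induction n arbitrary: i l)
    case 0
    then have "\<mu> (Suc 0) 0 = 0" "i = 0 \<and> l = Suc 0 \<or> i = Suc 0 \<and> l = 0"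
      using N(2) [of 0] by auto
    then show ?case
      using cnj_\<mu> [of "Suc 0"] by auto
  next
    case (Suc n)
    consider "i = 0" "l = Suc (Suc n)" | "l = 0" "i = Suc (Suc n)"
      | i' l' where "i = Suc i'" "l = Suc l'"
      using Suc.prems by (cases i; cases l) auto
    then show ?case
    proof cases
      case 1
      then show ?thesis
        using cnj_\<mu> [of l] N(2) [of "Suc n"] Suc.prems by simp
    next
      case 2
      then show ?thesis
        using N(2) [of "Suc n"] Suc.prems by simp
    next
      case (3 i' l')
      then have "\<mu> (Suc i') l' = 0" "\<mu> i' (Suc l') = 0"
        using Suc.prems by (auto intro!: Suc.IH)
      then show ?thesis
        using rec [of i' l'] \<open>\<kappa> \<noteq> 0\<close> 3 by simp
    qed
  qed
  have expand: "(\<Sum>j\<in>J. of_real (b j) * s j * coulomb_poly n (s j * w))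
     = (\<Sum>i\<le>n. ((-3/2) gchoose i) * ((-1/2) gchoose (n - i)) * w ^ i * cnj w ^ (n - i) * \<mu> (Suc i) (n - i))" for n w
    unfolding \<mu>_def coulomb_poly_def sum_distrib_left
    by (subst sum.swap) (simp add: power_mult_distrib mult_ac)
  have lead: "(\<Sum>j\<in>J. of_real (b j) * s j * coulomb_poly N (s j * w))
     = ((-3/2) gchoose N) * w ^ N * \<mu> (Suc N) 0" for w
  proof -
    have "\<mu> (Suc i) (N - i) = 0" if i: "i < N" for i
    proof -
      obtain l where l: "N - i = Suc l" "N = Suc (i + l)"
        using i by (metis Suc_diff_Suc add_Suc_right le_add_diff_inverse less_imp_le)
      have "\<mu> (Suc i) l = 0" "\<mu> i (Suc l) = 0"
        using l by (auto intro!: zero [of _ _ "i + l"])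
      then show ?thesis
        using rec [of i l] \<open>\<kappa> \<noteq> 0\<close> l by simp
    qed
    then show ?thesis
      unfolding expand by (simp add: lessThan_Suc_atMost [symmetric])
  qed
  have "(-3/2 :: complex) gchoose N \<noteq> 0"
  proof
    assume "(-3/2 :: complex) gchoose N = 0"
    then have "pochhammer (3/2 :: complex) N = 0"
      by (simp add: gbinomial_pochhammer)
    moreover have "pochhammer (3/2 :: complex) N = of_real (pochhammer (3/2) N)"
      by (simp flip: pochhammer_of_real)
    ultimately show False
      using pochhammer_pos [of "3/2 :: real" N] by simp
  qed
  then show ?thesis
    using assms(1) N(1)
    by (intro superposition_nonzero_of_leading_term [of J N])
       (auto simp: lead expand zero intro!: sum.neutral)
qed

section \<open>Isolation of the zeros in the extended plane\<close>

text \<open>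
  An arbitrary finite index set allows charges of strength zero to be discarded.
\<close>

definition complex_field :: "'i set \<Rightarrow> ('i \<Rightarrow> real) \<Rightarrow> ('i \<Rightarrow> real) \<Rightarrow> complex \<Rightarrow> complex" where
  "complex_field J a x z = (\<Sum>j\<in>J. of_real (a j) * coulomb (z - of_real (x j)))"

lemma eventually_complex_field_nonzero_regular:
  assumes J: "finite J" "J \<noteq> {}" "inj_on x J" "\<And>j. j \<in> J \<Longrightarrow> a j \<noteq> 0"
    and z0: "\<And>j. j \<in> J \<Longrightarrow> z0 \<noteq> of_real (x j)"
  shows "\<forall>\<^sub>F z in at z0. complex_field J a x z \<noteq> 0"
proof -
  obtain k where k: "k \<in> J"
    using J by auto
  define s where "s j = 1 / (z0 - of_real (x j))" for j
  have s0: "s j \<noteq> 0" if "j \<in> J" for j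
    using z0 [OF that] by (simp add: s_def)
  have inj: "inj_on s J"
    using J(3) by (auto simp: inj_on_def s_def)
  have factor: "complex_field J a x (z0 + w)
      = (\<Sum>j\<in>J. of_real (a j) * coulomb (1 / s j) * coulomb (1 + s j * w))" for w
    unfolding complex_field_def
  proof (rule sum.cong [OF refl])
    fix j assume "j \<in> J"
    then have "z0 + w - of_real (x j) = 1 / s j * (1 + s j * w)"
      using z0 by (simp add: s_def field_simps)
    then show "of_real (a j) * coulomb (z0 + w - of_real (x j))
        = of_real (a j) * coulomb (1 / s j) * coulomb (1 + s j * w)"
      by (simp only: coulomb_mult mult.assoc)
  qed
  have "\<forall>\<^sub>F w in at 0. complex_field J a x (z0 + w) \<noteq> 0"
  proof (cases "z0 \<in> \<real>")
    case True
    then have s: "of_real (Re (s j)) = s j" for j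
      by (auto simp: s_def elim!: Reals_cases simp flip: of_real_diff)
    have "inj_on (\<lambda>j. Re (s j)) J"
      using inj s unfolding inj_on_def by metis
    from superposition_nonzero_real [OF J(1) this k, of "\<lambda>j. of_real (a j) * coulomb (1 / s j)"]
    show ?thesis
      using J(4) [OF k] s0 [OF k] by (simp add: factor s)
  next
    case False
    \<comment> \<open>Subtracting \<open>1 / s j = z0 - x j\<close> from its conjugate eliminates the real number \<open>x j\<close>, so the
      factor \<open>\<kappa>\<close> of the circle equation is the same for all charges.\<close>
    define \<kappa> where "\<kappa> = cnj z0 - z0"
    have "\<kappa> \<noteq> 0"
      using False by (auto simp: \<kappa>_def Reals_cnj_iff)
    moreover have "s j - cnj (s j) = \<kappa> * (s j * cnj (s j))" if "j \<in> J" for j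
    proof -
      have "z0 - of_real (x j) \<noteq> 0" "cnj z0 - of_real (x j) \<noteq> 0"
        using z0 [OF that] by (auto simp: complex_eq_iff)
      then show ?thesis
        by (simp add: s_def \<kappa>_def field_simps)
    qed
    moreover have "of_real (a j) * coulomb (1 / s j) = of_real (a j * norm (s j)) * s j" if "j \<in> J" for j
    proof -
      have "s j * cnj (s j) = of_real (norm (s j)) ^ 2"
        using complex_norm_square [of "s j"] by simp
      then show ?thesis
        using s0 [OF that]
        by (simp add: coulomb_def norm_divide field_simps power2_eq_square power3_eq_cube)
    qed
    ultimately show ?thesis
      using superposition_nonzero_nonreal [OF J(1) inj k, of "\<lambda>j. a j * norm (s j)" \<kappa>] J(4) k s0
      by (simp add: factor mult.assoc)
  qed
  then show ?thesis
    by (subst at_to_0) (simp add: eventually_filtermap add.commute)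
qed

text \<open>
  Multiplied by the squared distance to the charge \<open>k\<close>, the field of the other charges tends to \<open>0\<close>,
  whereas that of \<open>k\<close> keeps the absolute value \<open>\<bar>a\<^sub>k\<bar>\<close>.
\<close>

lemma eventually_complex_field_nonzero_charge:
  assumes J: "finite J" "inj_on x J" "k \<in> J" "a k \<noteq> 0"
  shows "\<forall>\<^sub>F z in at (of_real (x k)). complex_field J a x z \<noteq> 0"
proof -
  define R where "R z = (\<Sum>j\<in>J - {k}. of_real (a j) * coulomb (z - of_real (x j)))" for z
  have "((\<lambda>z. norm (R z) * norm (z - of_real (x k)) ^ 2)
      \<longlongrightarrow> norm (R (of_real (x k))) * norm (of_real (x k) - of_real (x k) :: complex) ^ 2) (at (of_real (x k)))"
  proof (intro tendsto_intros)
    show "(R \<longlongrightarrow> R (of_real (x k))) (at (of_real (x k)))"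
      unfolding R_def
    proof (intro tendsto_intros)
      fix j assume "j \<in> J - {k}"
      then have "complex_of_real (x k) - of_real (x j) \<noteq> 0"
        using J by (auto simp: inj_on_def)
      then have "isCont coulomb (of_real (x k) - of_real (x j))"
        using continuous_on_coulomb by (auto simp: continuous_on_eq_continuous_at open_Compl)
      then show "((\<lambda>z. coulomb (z - of_real (x j))) \<longlongrightarrow> coulomb (of_real (x k) - of_real (x j))) (at (of_real (x k)))"
        by (rule isCont_tendsto_compose) (intro tendsto_intros)
    qed
  qed
  then have "\<forall>\<^sub>F z in at (of_real (x k)). norm (R z) * norm (z - of_real (x k)) ^ 2 < \<bar>a k\<bar>"
    by (rule order_tendstoD) (use J in auto)
  moreover have "\<forall>\<^sub>F z in at (of_real (x k)). z \<noteq> complex_of_real (x k)"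
    by (simp add: eventually_at_filter)
  ultimately show ?thesis
  proof eventually_elim
    case (elim z)
    show ?case
    proof
      assume "complex_field J a x z = 0"
      then have "of_real (a k) * coulomb (z - of_real (x k)) = - R z"
        using J by (simp add: complex_field_def R_def sum.remove [of J k] eq_neg_iff_add_eq_0)
      then have "norm (of_real (a k) * coulomb (z - of_real (x k))) = norm (R z)"
        by simp
      then have "\<bar>a k\<bar> = norm (R z) * norm (z - of_real (x k)) ^ 2"
        using elim(2) by (simp add: coulomb_def norm_mult norm_divide norm_power divide_simps
            power2_eq_square power3_eq_cube mult_ac del: complex_cnj_diff)
      then show False
        using elim(1) by simp
    qed
  qed
qed

text \<open>
  Since \<open>z - x\<^sub>j = z (1 - x\<^sub>j / z)\<close>, multiplicativity gives \<open>k(z - x\<^sub>j) = k(z) k(1 - x\<^sub>j w)\<close> for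
  \<open>w = 1/z\<close>, so infinity behaves like a point of the axis.
\<close>

lemma eventually_complex_field_nonzero_at_infinity:
  assumes J: "finite J" "J \<noteq> {}" "inj_on x J" "\<And>j. j \<in> J \<Longrightarrow> a j \<noteq> 0"
  shows "\<forall>\<^sub>F z in at_infinity. complex_field J a x z \<noteq> 0"
proof -
  obtain k where k: "k \<in> J"
    using J by auto
  have "inj_on (\<lambda>j. - x j) J"
    using J(3) by (auto simp: inj_on_def)
  then have "\<forall>\<^sub>F w in at 0. (\<Sum>j\<in>J. of_real (a j) * coulomb (1 + of_real (- x j) * w)) \<noteq> 0"
    using J k by (intro superposition_nonzero_real) auto
  then have "\<forall>\<^sub>F z in at_infinity. (\<Sum>j\<in>J. of_real (a j) * coulomb (1 + of_real (- x j) * inverse z)) \<noteq> 0"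
    by (simp only: at_to_infinity eventually_filtermap)
  moreover have "\<forall>\<^sub>F z::complex in at_infinity. z \<noteq> 0"
    by (rule eventually_not_equal_at_infinity)
  ultimately show ?thesis
  proof eventually_elim
    case (elim z)
    have "complex_field J a x z = coulomb z * (\<Sum>j\<in>J. of_real (a j) * coulomb (1 + of_real (- x j) * inverse z))"
      unfolding complex_field_def sum_distrib_left
    proof (rule sum.cong [OF refl])
      fix j
      have "z - of_real (x j) = z * (1 + of_real (- x j) * inverse z)"
        using elim by (simp add: field_simps)
      then show "of_real (a j) * coulomb (z - of_real (x j))
          = coulomb z * (of_real (a j) * coulomb (1 + of_real (- x j) * inverse z))"
        by (simp add: coulomb_mult)
    qed
    then show ?case
      using elim by simp
  qed
qed

section \<open>Finiteness of the zero set\<close>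

lemma finite_complex_field_zeros:
  assumes J: "finite J" "J \<noteq> {}" "inj_on x J" "\<And>j. j \<in> J \<Longrightarrow> a j \<noteq> 0"
  shows "finite {z. complex_field J a x z = 0}" (is "finite ?Z")
proof (rule ccontr)
  assume inf: "infinite ?Z"
  have "\<forall>\<^sub>F z in at_infinity. complex_field J a x z \<noteq> 0"
    by (rule eventually_complex_field_nonzero_at_infinity [OF J])
  then obtain B where B: "\<And>z. B \<le> norm z \<Longrightarrow> complex_field J a x z \<noteq> 0"
    unfolding eventually_at_infinity by blast
  have "norm z \<le> B" if "z \<in> ?Z" for z
    using B [of z] that by (cases "norm z \<le> B") auto
  then have "bounded ?Z"
    by (rule boundedI)
  then obtain p where "p islimpt ?Z"
    using inf bounded_infinite_imp_islimpt by blast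
  moreover have "\<forall>\<^sub>F z in at p. complex_field J a x z \<noteq> 0"
  proof (cases "\<exists>k\<in>J. p = of_real (x k)")
    case True
    then obtain k where "k \<in> J" "p = of_real (x k)"
      by blast
    then show ?thesis
      using eventually_complex_field_nonzero_charge [OF J(1,3), of k a] J(4) by simp
  next
    case False
    then show ?thesis
      by (intro eventually_complex_field_nonzero_regular [OF J]) auto
  qed
  ultimately show False
    by (simp add: islimpt_iff_eventually)
qed

lemma complex_field_eq:
  "complex_field {1..M} a x (Complex u v) = Complex (field_X M a x u v) (- field_Y M a x u v)"
proof -
  have "of_real (a j) * coulomb (Complex u v - of_real (x j))
      = Complex (a j * (u - x j) / ((u - x j)\<^sup>2 + v\<^sup>2) powr (3/2))
          (- (a j * v / ((u - x j)\<^sup>2 + v\<^sup>2) powr (3/2)))" for j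
  proof -
    have "r powr (3/2) = sqrt r ^ 3" if "0 \<le> r" for r :: real
    proof -
      have "r powr (3/2) = (r powr (1/2)) powr 3"
        by (simp add: powr_powr)
      also have "\<dots> = sqrt r ^ 3"
        using that by (simp add: powr_half_sqrt powr_numeral)
      finally show ?thesis .
    qed
    then have "((u - x j)\<^sup>2 + v\<^sup>2) powr (3/2) = sqrt ((u - x j)\<^sup>2 + v\<^sup>2) ^ 3"
      by simp
    also have "\<dots> = norm (Complex u v - of_real (x j)) ^ 3"
      by (simp add: cmod_def)
    finally show ?thesis
      by (simp add: coulomb_def complex_eq_iff)
  qed
  then show ?thesis
    by (simp add: complex_field_def field_X_def field_Y_def complex_eq_iff sum_negf)
qed

theorem proposition2p3:
  fixes M :: nat and a x :: "nat \<Rightarrow> real"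
  assumes "1 \<le> M"
    and "0 < x 1"
    and "strict_mono_on {1..M} x"
    and "\<exists>j\<in>{1..M}. a j \<noteq> 0"
  shows "finite (field_zeros M a x)"
proof -
  define J where "J = {j\<in>{1..M}. a j \<noteq> 0}"
  have "inj_on x J"
    using strict_mono_on_imp_inj_on [OF assms(3)] by (rule inj_on_subset) (auto simp: J_def)
  then have fin: "finite {z. complex_field J a x z = 0}"
    using assms(4) by (intro finite_complex_field_zeros) (auto simp: J_def)
  have eq: "complex_field J a x = complex_field {1..M} a x"
    unfolding complex_field_def J_def by (intro ext sum.mono_neutral_left) auto
  have "field_zeros M a x \<subseteq> (\<lambda>z. (Re z, Im z)) ` {z. complex_field J a x z = 0}"
  proof
    fix p assume "p \<in> field_zeros M a x"
    then obtain u v where "p = (u, v)" "field_X M a x u v = 0" "field_Y M a x u v = 0"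
      by (auto simp: field_zeros_def)
    then have "complex_field J a x (Complex u v) = 0" "p = (Re (Complex u v), Im (Complex u v))"
      unfolding eq complex_field_eq by (auto simp: complex_eq_iff)
    then show "p \<in> (\<lambda>z. (Re z, Im z)) ` {z. complex_field J a x z = 0}"
      by blast
  qed
  then show ?thesis
    using fin finite_surj by blast
qed

end
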